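(* Let $K\subset\mathbb{R}^2$ be a connected compact body and let $\mu$ be a probability measure on $(K,\mathcal{B}(K))$ such that $\mu(B(p,\varepsilon)\cap K)>0$ for all $p\in K$ and $\varepsilon>0$, and such that $\mu(\{(\alpha,\beta)\in K:\alpha=x\})=0=\mu(\{(\alpha,\beta)\in K:\beta=y\})$ for all $x,y\in\mathbb{R}$. Let $(t_k)_{k\in\mathbb{N}}$ be a decreasing sequence of positive numbers with $\sum_{k=1}^\infty t_k=\infty$ and $\sum_{k=1}^\infty t_k^2<\infty$, let $x_0\in K$ be arbitrary, and let $(X_k)_{k\ge 0}$ be the sequence of $\mathbb{R}^2$-valued random variables defined by the recursion $X_0=x_0$, $X_{k+1}=X_k-t_{k+1}Q_{k+1}$ described in the context. Then $(X_k)$ converges almost surely and in $L^q$, for every $q\in\mathbb{N}$, to the unique global minimizer $X^*$ of the generalized conic function $F_{K,\mu}$; that is, $\mathbb{P}(\lim_{n\to\infty}X_n=X^* )=1$ and $\lim_{n\to\infty}\mathbb{E}\Vert X_n-X^*\Vert^q=0$ for every $q\in\mathbb{N}$.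
   Context: A compact body in $\mathbb{R}^2$ is a non-empty compact set that coincides with the closure of its interior. $\mathbb{N}$ denotes the positive integers, $\mathcal{B}(K)$ is the Borel $\sigma$-algebra on $K$, $\Vert\cdot\Vert$ is the Euclidean norm, and $B(p,\varepsilon)$ is the open Euclidean ball around $p$ with radius $\varepsilon$. The generalized conic function associated with $K$ and a finite measure $\mu$ on $(K,\mathcal{B}(K))$ is $F_{K,\mu}:\mathbb{R}^2\to\mathbb{R}$, $$F_{K,\mu}(x,y):=\int_K\big(|x-\alpha|+|y-\beta|\big)\,\mu(d\alpha,d\beta).$$ The recursion: let $(P_k)_{k\in\mathbb{N}}$, $P_k=(P_k^{(1)},P_k^{(2)})$, be a sequence of independent identically distributed $\mathbb{R}^2$-valued random variables with common distribution $\mu$ (regarded as a probability measure on $\mathbb{R}^2$ concentrated on $K$). Set $X_0:=x_0$ and, for $k\ge 0$, with $X_k=(X_k^{(1)},X_k^{(2)})$, $X_{k+1}:=X_k-t_{k+1}Q_{k+1}$, where $Q_{k+1}=(Q_{k+1}^{(1)},Q_{k+1}^{(2)})^\top$ with, for $j=1,2$, $Q_{k+1}^{(j)}=1$ if $X_k^{(j)}\ge P_{k+1}^{(j)}$ and $Q_{k+1}^{(j)}=-1$ if $X_k^{(j)}<P_{k+1}^{(j)}$. *)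

theory Defs
  imports "HOL-Probability.Probability"
begin

text \<open>
  The plane is the type \<open>real \<times> real\<close>, whose \<open>norm\<close> and \<open>ball\<close> are the Euclidean ones.
\<close>

definition compact_body :: "(real \<times> real) set \<Rightarrow> bool" where
  "compact_body K \<longleftrightarrow> K \<noteq> {} \<and> compact K \<and> closure (interior K) = K"

definition generalized_conic ::
  "(real \<times> real) set \<Rightarrow> (real \<times> real) measure \<Rightarrow> real \<times> real \<Rightarrow> real" where
  "generalized_conic K \<mu> z = (LINT p:K|\<mu>. \<bar>fst z - fst p\<bar> + \<bar>snd z - snd p\<bar>)"

definition global_minimizer :: "('b \<Rightarrow> real) \<Rightarrow> 'b \<Rightarrow> bool" where
  "global_minimizer F z \<longleftrightarrow> (\<forall>y. F z \<le> F y)"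

definition step_direction :: "real \<times> real \<Rightarrow> real \<times> real \<Rightarrow> real \<times> real" where
  "step_direction x p =
     (if fst x \<ge> fst p then 1 else - 1, if snd x \<ge> snd p then 1 else - 1)"

text \<open>
  The sequences \<open>t\<close> and \<open>P\<close> are indexed by the positive integers; their values at \<open>0\<close> are
  never used.
\<close>

primrec stoch_iter ::
  "(nat \<Rightarrow> real) \<Rightarrow> (nat \<Rightarrow> 'a \<Rightarrow> real \<times> real) \<Rightarrow> real \<times> real \<Rightarrow> nat \<Rightarrow> 'a \<Rightarrow> real \<times> real" where
  "stoch_iter t P x\<^sub>0 0 \<omega> = x\<^sub>0"
| "stoch_iter t P x\<^sub>0 (Suc k) \<omega> =
     stoch_iter t P x\<^sub>0 k \<omega>
       - t (Suc k) *\<^sub>R step_direction (stoch_iter t P x\<^sub>0 k \<omega>) (P (Suc k) \<omega>)"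

text \<open>
  For \<open>\<mu>\<close> a measure on the Borel subsets of \<open>K\<close>, the push-forward \<open>distr \<mu> borel (\<lambda>p. p)\<close> along
  the inclusion is \<open>\<mu>\<close> regarded as a measure on the whole plane.  Measurability of each \<open>P k\<close>
  with \<open>k \<ge> 1\<close> is part of \<open>indep_vars\<close>.
\<close>

definition iid_sample ::
  "'a measure \<Rightarrow> (nat \<Rightarrow> 'a \<Rightarrow> real \<times> real) \<Rightarrow> (real \<times> real) measure \<Rightarrow> bool" where
  "iid_sample M P \<mu> \<longleftrightarrow>
     prob_space.indep_vars M (\<lambda>_. borel) P {1..} \<and>
     (\<forall>k\<ge>1. distr M borel (P k) = distr \<mu> borel (\<lambda>p. p))"

end

theory Submission
  imports Defs
begin

text \<open>
  The taxicab distance and the step direction both split into coordinates.  Hence the conic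
  function is the sum of the mean absolute deviations of the two marginals of \<open>\<mu>\<close>, and the
  recursion consists of two walks on the line, each of which moves by \<open>t k\<close> towards the next sample.
  The marginals have no atoms, and since \<open>K\<close> is connected and \<open>\<mu>\<close> charges every ball around a point
  of \<open>K\<close>, each of them has a unique median (\<open>marginal_unique_median\<close>).  The median is the unique
  minimizer of the mean absolute deviation (\<open>median_minimizes_abs_deviation\<close>), so the pair of medians
  is the unique minimizer of the conic function.

  Almost sure convergence of a walk to the median \<open>m\<close> rests on monotonicity rather than on martingale
  convergence.  Fix a level \<open>c > m\<close>.  While the walk is above \<open>c\<close>, it descends at least as fast as the
  sums of \<open>t k * side c (p k)\<close>.  These summands are independent, because \<open>c\<close> does not depend on the
  walk.  Their means are \<open>t k\<close> times the positive number \<open>2 * cdf \<nu> c - 1\<close>, where \<open>\<nu>\<close> is the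
  distribution of the samples, and they add up to infinity; the centred summands have summable
  variances, so their series converges almost surely by Kolmogorov's one-series theorem
  (\<open>kolmogorov_one_series\<close>).  A deterministic argument (\<open>eventually_below_level\<close>) then shows that the
  walk is eventually below \<open>c + \<delta>\<close> for every \<open>\<delta> > 0\<close>.  Levels below \<open>m\<close> are treated by reflection.

  Finally the walks are bounded, because the samples lie in the compact set \<open>K\<close> and the step lengths
  decrease.  Dominated convergence turns almost sure convergence into convergence of all moments.
\<close>

section \<open>Kolmogorov's maximal inequality and one-series theorem\<close>

text \<open>
  The partial sums of \<open>x\<close> from index \<open>m\<close> on, frozen as soon as they reach modulus \<open>e\<close>.  Freezing
  turns a statement about the maximum of the partial sums into one about a single
  variable, to which Markov's inequality applies.
\<close>

primrec stopped_sum :: "real \<Rightarrow> (nat \<Rightarrow> real) \<Rightarrow> nat \<Rightarrow> nat \<Rightarrow> real" where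
  "stopped_sum e x m 0 = 0"
| "stopped_sum e x m (Suc n) =
     stopped_sum e x m n + (if \<bar>stopped_sum e x m n\<bar> < e then x (m + n) else 0)"

lemma stopped_sum_eq_sum:
  assumes "\<And>j. j < n \<Longrightarrow> \<bar>\<Sum>i=m..<m+j. x i\<bar> < e"
  shows "stopped_sum e x m n = (\<Sum>i=m..<m+n. x i)"
  using assms by (induction n) auto

lemma stopped_sum_exceeds:
  assumes "\<exists>j\<le>n. e \<le> \<bar>\<Sum>i=m..<m+j. x i\<bar>"
  shows "e \<le> \<bar>stopped_sum e x m n\<bar>"
  using assms
proof (induction n)
  case 0
  then show ?case by simp
next
  case (Suc n)
  show ?case
  proof (cases "\<exists>j\<le>n. e \<le> \<bar>\<Sum>i=m..<m+j. x i\<bar>")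
    case True
    with Suc.IH show ?thesis by simp
  next
    case False
    then have "\<And>j. j < Suc n \<Longrightarrow> \<bar>\<Sum>i=m..<m+j. x i\<bar> < e"
      by (metis less_Suc_eq_le not_less)
    from stopped_sum_eq_sum[OF this] Suc.prems False show ?thesis
      by (metis le_Suc_eq)
  qed
qed

text \<open>
  The first \<open>n\<close> steps only look at the coordinates \<open>m, ..., m + n - 1\<close>.  This is what makes the
  stopped sum independent of the next summand.
\<close>

lemma stopped_sum_restrict:
  assumes "n \<le> N"
  shows "stopped_sum e (restrict x {m..<m+N}) m n = stopped_sum e x m n"
  using assms by (induction n) auto

lemma measurable_stopped_sum:
  assumes "n \<le> N"
  shows "(\<lambda>x. stopped_sum e x m n) \<in> borel_measurable (PiM {m..<m+N} (\<lambda>_. borel))"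
  using assms
proof (induction n)
  case 0
  show ?case by simp
next
  case (Suc n)
  then have [measurable]: "(\<lambda>x. stopped_sum e x m n) \<in> borel_measurable (PiM {m..<m+N} (\<lambda>_. borel))"
    by simp
  have [measurable]: "(\<lambda>x. x (m + n)) \<in> borel_measurable (PiM {m..<m+N} (\<lambda>_. borel))"
    using Suc.prems by (intro measurable_component_singleton) auto
  show ?case by simp
qed

context prob_space
begin

lemma indep_var_stopped_sum:
  fixes X :: "nat \<Rightarrow> 'a \<Rightarrow> real"
  assumes "indep_vars (\<lambda>_. borel) X UNIV"
  shows "indep_var borel (\<lambda>\<omega>. stopped_sum e (\<lambda>i. X i \<omega>) m n) borel (X (m + n))"
proof -
  have "indep_var
      borel ((\<lambda>x. stopped_sum e x m n) \<circ> (\<lambda>\<omega>. restrict (\<lambda>i. X i \<omega>) {m..<m+n}))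
      borel ((\<lambda>x. x (m + n)) \<circ> (\<lambda>\<omega>. restrict (\<lambda>i. X i \<omega>) {m+n}))"
    by (intro indep_var_compose[OF indep_var_restrict[OF assms]] measurable_stopped_sum) auto
  then show ?thesis
    by (simp add: comp_def stopped_sum_restrict)
qed

text \<open>
  The next increment of the stopped sum \<open>T\<close> is the summand \<open>Y\<close> times the indicator of \<open>\<bar>T\<bar> < e\<close>.
  When the square is expanded, the cross term is a function of \<open>T\<close> times the independent
  centred variable \<open>Y\<close>, so it has mean zero, and the remaining term is at most \<open>Y\<^sup>2\<close>.
\<close>

lemma stopped_sum_second_moment:
  fixes X :: "nat \<Rightarrow> 'a \<Rightarrow> real"
  assumes indep: "indep_vars (\<lambda>_. borel) X UNIV"
    and int: "\<And>i. integrable M (X i)" and sq: "\<And>i. integrable M (\<lambda>\<omega>. (X i \<omega>)\<^sup>2)"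
    and centred: "\<And>i. expectation (X i) = 0" and "e > 0"
  shows "integrable M (\<lambda>\<omega>. (stopped_sum e (\<lambda>i. X i \<omega>) m n)\<^sup>2) \<and>
    expectation (\<lambda>\<omega>. (stopped_sum e (\<lambda>i. X i \<omega>) m n)\<^sup>2)
      \<le> (\<Sum>i=m..<m+n. expectation (\<lambda>\<omega>. (X i \<omega>)\<^sup>2))"
proof (induction n)
  case 0
  show ?case by simp
next
  case (Suc n)
  define T where "T = (\<lambda>\<omega>. stopped_sum e (\<lambda>i. X i \<omega>) m n)"
  define Y where "Y = X (m + n)"
  define h where "h = (\<lambda>s::real. if \<bar>s\<bar> < e then s else 0)"
  define g where "g = (\<lambda>\<omega>. (if \<bar>T \<omega>\<bar> < e then 1 else 0) * (Y \<omega>)\<^sup>2)"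
  have indT: "indep_var borel T borel Y"
    unfolding T_def Y_def by (rule indep_var_stopped_sum[OF indep])
  then have [measurable]: "T \<in> borel_measurable M" "Y \<in> borel_measurable M"
    unfolding indep_var_eq by auto
  have h: "h \<in> borel_measurable borel"
    unfolding h_def by measurable
  have indh: "indep_var borel (\<lambda>\<omega>. h (T \<omega>)) borel Y"
    using indep_var_compose[OF indT h measurable_ident] by (simp add: comp_def id_def)
  have inth: "integrable M (\<lambda>\<omega>. h (T \<omega>))"
  proof (rule integrable_const_bound[where B = e])
    show "AE \<omega> in M. norm (h (T \<omega>)) \<le> e" using \<open>e > 0\<close> by (auto simp: h_def)
    show "(\<lambda>\<omega>. h (T \<omega>)) \<in> borel_measurable M" using indh unfolding indep_var_eq by blast
  qed
  have intY: "integrable M Y" unfolding Y_def by (rule int)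
  have cross_int: "integrable M (\<lambda>\<omega>. h (T \<omega>) * Y \<omega>)"
    by (rule indep_var_integrable[OF indh inth intY])
  have cross: "expectation (\<lambda>\<omega>. h (T \<omega>) * Y \<omega>) = 0"
    using indep_var_lebesgue_integral[OF indh inth intY] centred by (simp add: Y_def)
  have sqY: "integrable M (\<lambda>\<omega>. (Y \<omega>)\<^sup>2)" unfolding Y_def by (rule sq)
  have g_int: "integrable M g"
    by (rule Bochner_Integration.integrable_bound[OF sqY]) (auto simp: g_def)
  have g_le: "expectation g \<le> expectation (\<lambda>\<omega>. (Y \<omega>)\<^sup>2)"
    by (intro integral_mono g_int sqY) (auto simp: g_def)
  have T_int: "integrable M (\<lambda>\<omega>. (T \<omega>)\<^sup>2)"
    and T_le: "expectation (\<lambda>\<omega>. (T \<omega>)\<^sup>2) \<le> (\<Sum>i=m..<m+n. expectation (\<lambda>\<omega>. (X i \<omega>)\<^sup>2))"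
    using Suc.IH by (auto simp: T_def)
  have decomp: "(\<lambda>\<omega>. (stopped_sum e (\<lambda>i. X i \<omega>) m (Suc n))\<^sup>2)
      = (\<lambda>\<omega>. (T \<omega>)\<^sup>2 + 2 * (h (T \<omega>) * Y \<omega>) + g \<omega>)"
    by (auto simp: fun_eq_iff T_def Y_def h_def g_def power2_sum)
  show ?case
    unfolding decomp using T_int cross_int g_int cross T_le g_le by (simp add: Y_def)
qed

text \<open>
  If some partial sum reaches modulus \<open>e\<close>, then the stopped sum still has modulus at least \<open>e\<close>
  at time \<open>n\<close>; apply Markov's inequality to its square.
\<close>

lemma kolmogorov_maximal_inequality:
  fixes X :: "nat \<Rightarrow> 'a \<Rightarrow> real"
  assumes indep: "indep_vars (\<lambda>_. borel) X UNIV"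
    and int: "\<And>i. integrable M (X i)" and sq: "\<And>i. integrable M (\<lambda>\<omega>. (X i \<omega>)\<^sup>2)"
    and centred: "\<And>i. expectation (X i) = 0" and "e > 0"
  shows "prob {\<omega> \<in> space M. \<exists>j\<le>n. e \<le> \<bar>\<Sum>i=m..<m+j. X i \<omega>\<bar>}
    \<le> (\<Sum>i=m..<m+n. expectation (\<lambda>\<omega>. (X i \<omega>)\<^sup>2)) / e\<^sup>2"
proof -
  define T where "T = (\<lambda>\<omega>. stopped_sum e (\<lambda>i. X i \<omega>) m n)"
  have T: "T \<in> borel_measurable M"
    using indep_var_stopped_sum[OF indep, of e m n] unfolding T_def indep_var_eq by auto
  have mom: "integrable M (\<lambda>\<omega>. (T \<omega>)\<^sup>2)"
    "expectation (\<lambda>\<omega>. (T \<omega>)\<^sup>2) \<le> (\<Sum>i=m..<m+n. expectation (\<lambda>\<omega>. (X i \<omega>)\<^sup>2))"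
    using stopped_sum_second_moment[OF indep int sq centred \<open>e > 0\<close>, of m n] by (auto simp: T_def)
  have "prob {\<omega> \<in> space M. \<exists>j\<le>n. e \<le> \<bar>\<Sum>i=m..<m+j. X i \<omega>\<bar>} \<le> prob {\<omega> \<in> space M. e\<^sup>2 \<le> (T \<omega>)\<^sup>2}"
  proof (intro finite_measure_mono subsetI)
    fix \<omega> assume \<omega>: "\<omega> \<in> {\<omega> \<in> space M. \<exists>j\<le>n. e \<le> \<bar>\<Sum>i=m..<m+j. X i \<omega>\<bar>}"
    then have "e \<le> \<bar>T \<omega>\<bar>"
      unfolding T_def by (intro stopped_sum_exceeds) auto
    then have "e\<^sup>2 \<le> (T \<omega>)\<^sup>2"
      using \<open>e > 0\<close> by (metis less_imp_le power2_abs power_mono)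
    with \<omega> show "\<omega> \<in> {\<omega> \<in> space M. e\<^sup>2 \<le> (T \<omega>)\<^sup>2}" by simp
  next
    show "{\<omega> \<in> space M. e\<^sup>2 \<le> (T \<omega>)\<^sup>2} \<in> events"
      by (intro borel_measurable_le borel_measurable_const borel_measurable_power T)
  qed
  also have "\<dots> \<le> expectation (\<lambda>\<omega>. (T \<omega>)\<^sup>2) / e\<^sup>2"
    using \<open>e > 0\<close> by (intro integral_Markov_inequality_measure[OF mom(1) sets.empty_sets]) auto
  also have "\<dots> \<le> (\<Sum>i=m..<m+n. expectation (\<lambda>\<omega>. (X i \<omega>)\<^sup>2)) / e\<^sup>2"
    using mom(2) by (intro divide_right_mono) auto
  finally show ?thesis .
qed

text \<open>
  The maximal inequality, passed to the limit \<open>n \<rightarrow> \<infinity>\<close>, bounds the probability that the series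
  oscillates by \<open>e\<close> after index \<open>m\<close> by a tail of the convergent series of variances.
  Letting \<open>m\<close> grow shows that the partial sums are almost surely Cauchy.
\<close>

theorem kolmogorov_one_series:
  fixes X :: "nat \<Rightarrow> 'a \<Rightarrow> real"
  assumes indep: "indep_vars (\<lambda>_. borel) X UNIV"
    and int: "\<And>i. integrable M (X i)" and sq: "\<And>i. integrable M (\<lambda>\<omega>. (X i \<omega>)\<^sup>2)"
    and centred: "\<And>i. expectation (X i) = 0"
    and var: "summable (\<lambda>i. expectation (\<lambda>\<omega>. (X i \<omega>)\<^sup>2))"
  shows "AE \<omega> in M. summable (\<lambda>i. X i \<omega>)"
proof -
  define v where "v i = expectation (\<lambda>\<omega>. (X i \<omega>)\<^sup>2)" for i
  have v_nonneg: "v i \<ge> 0" for i by (simp add: v_def)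
  have v_sum: "summable v" using var by (simp add: v_def[abs_def])
  have [measurable]: "\<And>i. X i \<in> borel_measurable M"
    using indep unfolding indep_vars_def by simp
  define A where "A e m n = {\<omega> \<in> space M. \<exists>j\<le>n. e \<le> \<bar>\<Sum>i=m..<m+j. X i \<omega>\<bar>}" for e :: real and m n
  have A_sets: "A e m n \<in> events" for e m n
  proof -
    have [measurable]: "(\<lambda>\<omega>. \<Sum>i=m..<m+j. X i \<omega>) \<in> borel_measurable M" for j
      by (intro borel_measurable_sum) simp
    have "A e m n = (\<Union>j\<in>{..n}. {\<omega> \<in> space M. e \<le> \<bar>\<Sum>i=m..<m+j. X i \<omega>\<bar>})"
      by (auto simp: A_def)
    also have "\<dots> \<in> events" by (intro sets.finite_UN) auto
    finally show ?thesis .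
  qed
  have tail: "prob (\<Union>n. A e m n) \<le> (\<Sum>i. v (i + m)) / e\<^sup>2" if "e > 0" for e m
  proof (rule LIMSEQ_le_const2)
    show "(\<lambda>n. prob (A e m n)) \<longlonglongrightarrow> prob (\<Union>n. A e m n)"
    proof (rule finite_Lim_measure_incseq)
      show "range (A e m) \<subseteq> events" using A_sets by blast
      show "incseq (A e m)" 
        by (rule incseq_SucI) (auto simp: A_def intro: le_SucI)
    qed
    have "prob (A e m n) \<le> (\<Sum>i. v (i + m)) / e\<^sup>2" for n
    proof -
      have "prob (A e m n) \<le> (\<Sum>i=m..<m+n. v i) / e\<^sup>2"
        unfolding A_def v_def using kolmogorov_maximal_inequality[OF indep int sq centred that] .
      also have "(\<Sum>i=m..<m+n. v i) = (\<Sum>i<n. v (i + m))"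
        using sum.shift_bounds_nat_ivl[of v 0 m n] by (simp add: atLeast0LessThan add.commute)
      also have "\<dots> / e\<^sup>2 \<le> (\<Sum>i. v (i + m)) / e\<^sup>2"
        using v_sum v_nonneg
        by (intro divide_right_mono sum_le_suminf) (auto simp: summable_iff_shift)
      finally show ?thesis .
    qed
    then show "\<exists>N. \<forall>n\<ge>N. prob (A e m n) \<le> (\<Sum>i. v (i + m)) / e\<^sup>2" by blast
  qed
  have AE_small: "AE \<omega> in M. \<exists>m. \<forall>n. \<omega> \<notin> A e m n" if "e > 0" for e
  proof -
    define B where "B = (\<Inter>m. \<Union>n. A e m n)"
    have B_sets: "B \<in> events" unfolding B_def using A_sets by auto
    have "prob B \<le> 0"
    proof (rule LIMSEQ_le_const)
      have "(\<lambda>m. \<Sum>i. v (i + m)) \<longlonglongrightarrow> 0"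
        by (rule suminf_exist_split2[OF v_sum])
      from tendsto_divide[OF this tendsto_const, of "e\<^sup>2"] that
      show "(\<lambda>m. (\<Sum>i. v (i + m)) / e\<^sup>2) \<longlonglongrightarrow> 0" by simp
      have "prob B \<le> (\<Sum>i. v (i + m)) / e\<^sup>2" for m
        using A_sets by (intro order_trans[OF finite_measure_mono tail[OF that]]) (auto simp: B_def)
      then show "\<exists>N. \<forall>m\<ge>N. prob B \<le> (\<Sum>i. v (i + m)) / e\<^sup>2" by blast
    qed
    then have "AE \<omega> in M. \<omega> \<notin> B"
      using prob_eq_0[OF B_sets] by (simp add: measure_le_0_iff)
    then show ?thesis by eventually_elim (auto simp: B_def)
  qed
  have "AE \<omega> in M. \<forall>k. \<exists>m. \<forall>n. \<omega> \<notin> A (inverse (real (Suc k))) m n"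
    unfolding AE_all_countable using AE_small by simp
  with AE_space show ?thesis
  proof eventually_elim
    case (elim \<omega>)
    show ?case
    proof (rule summable_Cauchy[THEN iffD2], intro allI impI)
      fix e :: real assume "e > 0"
      then obtain k where k: "inverse (real (Suc k)) < e / 2"
        using reals_Archimedean[of "e / 2"] half_gt_zero by blast
      obtain m where m: "\<And>n. \<omega> \<notin> A (inverse (real (Suc k))) m n" using elim by blast
      have small: "\<bar>\<Sum>i=m..<n. X i \<omega>\<bar> < e / 2" if "n \<ge> m" for n
      proof -
        have "\<bar>\<Sum>i=m..<m + (n - m). X i \<omega>\<bar> < inverse (real (Suc k))"
          using m[of "n - m"] elim(1) unfolding A_def by (metis (mono_tags, lifting) mem_Collect_eq not_le order_refl)
        with that k show ?thesis by simp
      qed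
      have "norm (\<Sum>i=l..<n. X i \<omega>) < e" if "l \<ge> m" for l n
      proof (cases "l \<le> n")
        case True
        have "(\<Sum>i=m..<n. X i \<omega>) = (\<Sum>i=m..<l. X i \<omega>) + (\<Sum>i=l..<n. X i \<omega>)"
          using that True by (simp add: sum.atLeastLessThan_concat)
        moreover have "\<bar>\<Sum>i=m..<n. X i \<omega>\<bar> < e / 2" "\<bar>\<Sum>i=m..<l. X i \<omega>\<bar> < e / 2"
          using small that True by simp_all
        ultimately show ?thesis unfolding real_norm_def by linarith
      qed (use \<open>e > 0\<close> in auto)
      then show "\<exists>N. \<forall>l\<ge>N. \<forall>n. norm (\<Sum>i=l..<n. X i \<omega>) < e" by blast
    qed
  qed
qed

end

section \<open>Deterministic descent below a level\<close>

text \<open>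
  Above the level \<open>c\<close> the sequence loses at least \<open>a n\<close> up to a perturbation \<open>e n\<close>.  Since the
  \<open>a n\<close> have infinite sum and the perturbations a convergent one, the sequence cannot stay above
  \<open>c\<close> forever; and once below, a late excursion above \<open>c\<close> starts with a small overshoot \<open>\<tau> n\<close>
  and can later rise only by a difference of two partial sums of \<open>e\<close>, which is small as well.
\<close>

lemma eventually_below_level:
  fixes y a e \<tau> :: "nat \<Rightarrow> real"
  assumes descent: "\<And>n. y n > c \<Longrightarrow> y (Suc n) \<le> y n - a n - e n"
    and step: "\<And>n. y (Suc n) \<le> y n + \<tau> n"
    and "\<tau> \<longlonglongrightarrow> 0"
    and a_nonneg: "\<And>n. a n \<ge> 0"
    and a_div: "filterlim (\<lambda>n. \<Sum>k<n. a k) at_top sequentially"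
    and e_conv: "summable e" and "\<delta> > 0"
  shows "eventually (\<lambda>n. y n \<le> c + \<delta>) sequentially"
proof -
  define E where "E n = (\<Sum>k<n. e k)" for n
  have "Cauchy E"
    using e_conv unfolding E_def by (simp add: summable_iff_convergent convergent_Cauchy)
  then obtain N1 where N1: "\<And>m n. m \<ge> N1 \<Longrightarrow> n \<ge> N1 \<Longrightarrow> \<bar>E m - E n\<bar> < \<delta> / 2"
    using \<open>\<delta> > 0\<close> unfolding Cauchy_def dist_real_def by (meson half_gt_zero)
  have "eventually (\<lambda>n. \<tau> n < \<delta> / 2) sequentially"
    using \<open>\<tau> \<longlonglongrightarrow> 0\<close> \<open>\<delta> > 0\<close> by (intro order_tendstoD(2)[of \<tau> 0]) auto
  then obtain N2 where N2: "\<And>n. n \<ge> N2 \<Longrightarrow> \<tau> n < \<delta> / 2"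
    by (auto simp: eventually_sequentially)
  define N where "N = max N1 N2"
  have "\<exists>s\<ge>N. y s \<le> c"
  proof (rule ccontr)
    assume "\<not> (\<exists>s\<ge>N. y s \<le> c)"
    then have above: "y n > c" if "n \<ge> N" for n using that by (meson not_le)
    have bound: "y n + E n + (\<Sum>k<n. a k) \<le> y N + E N + (\<Sum>k<N. a k)" if "n \<ge> N" for n
      using that
    proof (induction n rule: dec_induct)
      case (step n)
      with descent[OF above[of n]] show ?case by (simp add: E_def)
    qed simp
    have "eventually (\<lambda>n. (\<Sum>k<n. a k) > y N + (\<Sum>k<N. a k) + \<delta> / 2 - c) sequentially"
      using a_div by (auto simp: filterlim_at_top_dense)
    then obtain n where "n \<ge> N" "(\<Sum>k<n. a k) > y N + (\<Sum>k<N. a k) + \<delta> / 2 - c"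
      by (metis eventually_sequentially nle_le)
    moreover from this have "\<bar>E N - E n\<bar> < \<delta> / 2" by (intro N1) (auto simp: N_def)
    ultimately show False using bound[of n] above[of n] by linarith
  qed
  then obtain s0 where s0: "s0 \<ge> N" "y s0 \<le> c" by blast
  \<comment> \<open>The witness \<open>s\<close> is the last index, from \<open>s0\<close> on, that directly follows a value at most \<open>c\<close>
    (or \<open>s0\<close> itself): the step to \<open>s\<close> overshot \<open>c\<close> by at most \<open>\<delta> / 2\<close>, and \<open>y + E\<close> has not increased
    since.\<close>
  have inv: "\<exists>s\<ge>N. y n + E n \<le> c + \<delta> / 2 + E s" if "n \<ge> s0" for n
    using that
  proof (induction n rule: dec_induct)
    case base
    show ?case using s0 \<open>\<delta> > 0\<close> by (intro exI[of _ s0]) auto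
  next
    case (step n)
    show ?case
    proof (cases "y n > c")
      case True
      have "y (Suc n) + E (Suc n) \<le> y n + E n"
        using descent[OF True] a_nonneg[of n] by (simp add: E_def)
      with step.IH show ?thesis by (meson order_trans)
    next
      case False
      have "y (Suc n) \<le> c + \<delta> / 2"
        using False assms(2)[of n] N2[of n] step.hyps s0 by (auto simp: N_def)
      then show ?thesis
        using step.hyps s0 by (intro exI[of _ "Suc n"]) auto
    qed
  qed
  have "y n \<le> c + \<delta>" if "n \<ge> s0" for n
  proof -
    from inv[OF that] obtain s where s: "s \<ge> N" "y n + E n \<le> c + \<delta> / 2 + E s" by blast
    have "\<bar>E s - E n\<bar> < \<delta> / 2" using s(1) that s0(1) by (intro N1) (auto simp: N_def)
    with s(2) show ?thesis by linarith
  qed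
  then show ?thesis by (auto simp: eventually_sequentially)
qed

section \<open>The one-dimensional recursion\<close>

text \<open>
  For \<open>p\<close> fixed, this is a subgradient of \<open>y \<mapsto> \<bar>y - p\<bar>\<close>; at the kink the value \<open>1\<close> is chosen,
  in accordance with the planar step direction.
\<close>

definition side :: "real \<Rightarrow> real \<Rightarrow> real" where
  "side y p = (if y \<ge> p then 1 else - 1)"

lemma side_mono: "y \<le> z \<Longrightarrow> side y p \<le> side z p"
  by (auto simp: side_def)

lemma abs_side [simp]: "\<bar>side y p\<bar> = 1"
  by (auto simp: side_def)

lemma borel_measurable_side: "side c \<in> borel_measurable borel"
  unfolding side_def by measurable

primrec median_walk :: "(nat \<Rightarrow> real) \<Rightarrow> (nat \<Rightarrow> real) \<Rightarrow> real \<Rightarrow> nat \<Rightarrow> real" where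
  "median_walk t p y 0 = y"
| "median_walk t p y (Suc k) =
     median_walk t p y k - t (Suc k) * side (median_walk t p y k) (p (Suc k))"

text \<open>
  Each coordinate of the step depends on the same coordinate of the position and of the sample
  only, so the planar recursion splits into two one-dimensional ones.
\<close>

lemma stoch_iter_eq_median_walks:
  "stoch_iter t P x n \<omega> =
    (median_walk t (\<lambda>k. fst (P k \<omega>)) (fst x) n, median_walk t (\<lambda>k. snd (P k \<omega>)) (snd x) n)"
  by (induction n) (auto simp: step_direction_def side_def)

text \<open>
  Outside \<open>[- B, B]\<close> every step leads back towards this interval, so the walk can leave it only by
  the length of one step.
\<close>

lemma median_walk_bounded:
  assumes t_pos: "\<And>k. k \<ge> 1 \<Longrightarrow> t k > 0" and t_decr: "\<And>k l. 1 \<le> k \<Longrightarrow> k \<le> l \<Longrightarrow> t l \<le> t k"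
    and p: "\<And>k. k \<ge> 1 \<Longrightarrow> \<bar>p k\<bar> \<le> B" and y: "\<bar>y\<bar> \<le> B"
  shows "\<bar>median_walk t p y n\<bar> \<le> B + t 1"
proof (induction n)
  case 0
  show ?case using y t_pos[of 1] by simp
next
  case (Suc n)
  with t_pos[of "Suc n"] t_decr[of 1 "Suc n"] p[of "Suc n"] show ?case
    by (auto simp: side_def)
qed

lemma measurable_median_walk:
  assumes "\<And>k. k \<ge> 1 \<Longrightarrow> p k \<in> borel_measurable M"
  shows "(\<lambda>\<omega>. median_walk t (\<lambda>k. p k \<omega>) y n) \<in> borel_measurable M"
proof (induction n)
  case (Suc n)
  note [measurable] = Suc assms[of "Suc n"]
  show ?case by (simp add: side_def)
qed simp

section \<open>Medians of real distributions\<close>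

text \<open>
  Strictness on both sides is what the walk needs: a drift of constant sign at every level other
  than \<open>m\<close>.
\<close>

definition unique_median :: "real measure \<Rightarrow> real \<Rightarrow> bool" where
  "unique_median M m \<longleftrightarrow> cdf M m = 1/2 \<and> (\<forall>x>m. cdf M x > 1/2) \<and> (\<forall>x<m. cdf M x < 1/2)"

context real_distribution
begin

lemma side_integrable: "integrable M (side c)"
  by (intro integrable_const_bound[where B = 1]) (auto simp: borel_measurable_side)

lemma expectation_side: "expectation (side c) = 2 * cdf M c - 1"
proof -
  have "expectation (side c) = expectation (\<lambda>p. 2 * indicator {..c} p - 1)"
    by (intro Bochner_Integration.integral_cong) (auto simp: side_def indicator_def)
  also have "\<dots> = 2 * prob {..c} - 1"
    by (subst Bochner_Integration.integral_diff) (use prob_space in \<open>auto simp: less_top[symmetric]\<close>)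
  finally show ?thesis by (simp add: cdf_def)
qed

text \<open>
  Without atoms the distribution function is continuous and takes the value \<open>1/2\<close>.  There is
  mass on either side of such a point \<open>m\<close>, hence points of \<open>S\<close> on either side, and by
  connectedness \<open>S\<close> contains a neighbourhood of \<open>m\<close>.  Every interval near \<open>m\<close> therefore has
  positive mass, so the distribution function is strictly increasing there.
\<close>

lemma unique_median_exists:
  assumes atomless: "\<And>x. measure M {x} = 0"
    and conn: "connected S" and conc: "\<And>A. A \<in> sets borel \<Longrightarrow> prob A > 0 \<Longrightarrow> \<exists>s\<in>S. s \<in> A"
    and supp: "\<And>s \<epsilon>. s \<in> S \<Longrightarrow> \<epsilon> > 0 \<Longrightarrow> measure M {s-\<epsilon><..<s+\<epsilon>} > 0"
  shows "\<exists>m. unique_median M m"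
proof -
  have cont: "isCont (cdf M) x" for x by (simp add: isCont_cdf atomless)
  have "eventually (\<lambda>x. cdf M x > 1/2) at_top"
    by (rule order_tendstoD(1)[OF cdf_lim_at_top_prob]) simp
  then obtain b where b: "\<And>x. x \<ge> b \<Longrightarrow> cdf M x > 1/2" by (auto simp: eventually_at_top_linorder)
  have "eventually (\<lambda>x. cdf M x < 1/2) at_bot"
    by (rule order_tendstoD(2)[OF cdf_lim_at_bot]) simp
  then obtain a where a: "\<And>x. x \<le> a \<Longrightarrow> cdf M x < 1/2" by (auto simp: eventually_at_bot_linorder)
  have "a \<le> b" using a[of b] b[of b] by linarith
  then obtain m where m: "cdf M m = 1/2"
    using IVT[of "cdf M" a "1/2" b] a[of a] b[of b] cont by force
  have "prob {..m} = prob {..<m} + prob {m}"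
    by (subst finite_measure_Union[symmetric]) (auto intro: arg_cong[where f = prob])
  then obtain s where s: "s \<in> S" "s < m"
    using conc[of "{..<m}"] m atomless[of m] by (auto simp: cdf_def)
  have "prob {m<..} = 1 - prob {..m}"
    by (subst prob_compl[symmetric]) (auto intro: arg_cong[where f = prob])
  then obtain s' where s': "s' \<in> S" "s' > m"
    using conc[of "{m<..}"] m by (auto simp: cdf_def)
  have S: "v \<in> S" if "s \<le> v" "v \<le> s'" for v
    using connectedD_interval[OF conn s(1) s'(1)] that by blast
  have pos: "prob {u<..w} > 0" if "s \<le> u" "u < w" "w \<le> s'" for u w
  proof -
    have "0 < prob {(u + w) / 2 - (w - u) / 2<..<(u + w) / 2 + (w - u) / 2}"
      using that by (intro supp S) auto
    also have "\<dots> = prob {u<..<w}" by (simp add: field_simps)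
    also have "\<dots> \<le> prob {u<..w}" by (intro finite_measure_mono) auto
    finally show ?thesis .
  qed
  have "cdf M x > 1/2" if "x > m" for x
    using cdf_diff_eq[of m "min x s'"] pos[of m "min x s'"] cdf_nondecreasing[of "min x s'" x] that s s' m
    by auto
  moreover have "cdf M x < 1/2" if "x < m" for x
    using cdf_diff_eq[of "max x s" m] pos[of "max x s" m] cdf_nondecreasing[of x "max x s"] that s s' m
    by auto
  ultimately show ?thesis using m by (auto simp: unique_median_def)
qed

lemma abs_deviation_integrable:
  assumes "integrable M (\<lambda>p. p)"
  shows "integrable M (\<lambda>p. \<bar>x - p\<bar>)"
  using assms by auto

text \<open>
  Integrate the pointwise subgradient inequality for the absolute value.
\<close>

lemma abs_deviation_subgradient:
  assumes "integrable M (\<lambda>p. p)"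
  shows "expectation (\<lambda>p. \<bar>x - p\<bar>) \<ge> expectation (\<lambda>p. \<bar>c - p\<bar>) + (x - c) * (2 * cdf M c - 1)"
proof -
  have "expectation (\<lambda>p. \<bar>c - p\<bar>) + (x - c) * (2 * cdf M c - 1)
      = expectation (\<lambda>p. \<bar>c - p\<bar> + (x - c) * side c p)"
    using abs_deviation_integrable[OF assms] side_integrable by (simp add: expectation_side)
  also have "\<dots> \<le> expectation (\<lambda>p. \<bar>x - p\<bar>)"
  proof (rule integral_mono)
    show "integrable M (\<lambda>p. \<bar>c - p\<bar> + (x - c) * side c p)"
      using abs_deviation_integrable[OF assms] side_integrable by simp
    show "integrable M (\<lambda>p. \<bar>x - p\<bar>)" by (rule abs_deviation_integrable[OF assms])
    show "\<bar>c - p\<bar> + (x - c) * side c p \<le> \<bar>x - p\<bar>" for p by (auto simp: side_def)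
  qed
  finally show ?thesis .
qed

text \<open>
  Two subgradient inequalities are chained through the midpoint \<open>c\<close> of \<open>m\<close> and \<open>x\<close>: the one at
  \<open>m\<close> has slope zero, and the slope at \<open>c\<close> is strict because \<open>c\<close> is not a median.
\<close>

lemma median_minimizes_abs_deviation:
  assumes int: "integrable M (\<lambda>p. p)" and med: "unique_median M m" and "x \<noteq> m"
  shows "expectation (\<lambda>p. \<bar>m - p\<bar>) < expectation (\<lambda>p. \<bar>x - p\<bar>)"
proof -
  define c where "c = (m + x) / 2"
  have "(x - c) * (2 * cdf M c - 1) > 0"
  proof (cases "x > m")
    case True
    then have "x > c" "c > m" by (auto simp: c_def)
    then show ?thesis using med by (auto simp: unique_median_def)
  next
    case False
    then have "x < c" "c < m" using \<open>x \<noteq> m\<close> by (auto simp: c_def)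
    then show ?thesis using med by (auto simp: unique_median_def intro!: mult_neg_neg)
  qed
  moreover have "2 * cdf M m - 1 = 0" using med by (simp add: unique_median_def)
  ultimately show ?thesis
    using abs_deviation_subgradient[OF int, of c x] abs_deviation_subgradient[OF int, of m c] by simp
qed

end

section \<open>Almost sure convergence to the median\<close>

text \<open>
  With the level \<open>c\<close> fixed, the terms are independent functions of the individual samples, even
  though the increments of the walk itself are not.  They are centred and bounded in modulus
  by \<open>2 * \<bar>t\<bar>\<close>, so Kolmogorov's theorem applies.
\<close>

lemma (in prob_space) sampled_sides_series:
  fixes p :: "nat \<Rightarrow> 'a \<Rightarrow> real"
  assumes indep: "indep_vars (\<lambda>_. borel) p {1..}"
    and distr: "\<And>k. k \<ge> 1 \<Longrightarrow> distr M borel (p k) = \<nu>" and nu: "real_distribution \<nu>"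
    and t_sq: "summable (\<lambda>k. (t (Suc k))\<^sup>2)"
  shows "AE \<omega> in M. summable (\<lambda>k. t (Suc k) * (side c (p (Suc k) \<omega>) - (2 * cdf \<nu> c - 1)))"
proof -
  interpret nu: real_distribution \<nu> by (rule nu)
  define g where "g = 2 * cdf \<nu> c - 1"
  define X where "X k \<omega> = t (Suc k) * (side c (p (Suc k) \<omega>) - g)" for k \<omega>
  have g: "\<bar>g\<bar> \<le> 1"
    using nu.cdf_nonneg[of c] nu.cdf_bounded_prob[of c] by (simp add: g_def)
  note side_meas = borel_measurable_side[of c]
  have p_meas: "p (Suc k) \<in> borel_measurable M" for k
    using indep by (simp add: indep_vars_def)
  have X_meas: "X k \<in> borel_measurable M" for k
    unfolding X_def
    by (intro borel_measurable_times borel_measurable_diff borel_measurable_const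
        measurable_compose[OF p_meas side_meas])
  have X_bound: "\<bar>X k \<omega>\<bar> \<le> 2 * \<bar>t (Suc k)\<bar>" for k \<omega>
  proof -
    have "\<bar>side c (p (Suc k) \<omega>) - g\<bar> \<le> 2" using g by (auto simp: side_def)
    from mult_left_mono[OF this, of "\<bar>t (Suc k)\<bar>"] show ?thesis
      by (simp add: X_def abs_mult mult.commute)
  qed
  have X_sq_bound: "(X k \<omega>)\<^sup>2 \<le> 4 * (t (Suc k))\<^sup>2" for k \<omega>
    using power_mono[OF X_bound, of k \<omega> 2] by (simp add: power_mult_distrib)
  have X_int: "integrable M (X k)" for k
    using X_bound X_meas by (intro integrable_const_bound[where B = "2 * \<bar>t (Suc k)\<bar>"]) auto
  have X_sq_int: "integrable M (\<lambda>\<omega>. (X k \<omega>)\<^sup>2)" for k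
    using X_sq_bound X_meas
    by (intro integrable_const_bound[where B = "4 * (t (Suc k))\<^sup>2"] borel_measurable_power) auto
  have side_int: "integrable M (\<lambda>\<omega>. side c (p (Suc k) \<omega>))" for k
    using measurable_compose[OF p_meas side_meas]
    by (intro integrable_const_bound[where B = 1]) auto
  have "expectation (\<lambda>\<omega>. side c (p (Suc k) \<omega>)) = g" for k
    using integral_distr[OF p_meas side_meas, of k] distr[of "Suc k"] nu.expectation_side[of c]
    by (simp add: g_def)
  then have X_mean: "expectation (X k) = 0" for k
    unfolding X_def using side_int by (simp add: prob_space)
  \<comment> \<open>The samples are indexed from \<open>1\<close> on, the terms of the series from \<open>0\<close> on; grouping the samples
    into singletons performs the shift.\<close>
  have "indep_vars (\<lambda>k. PiM {Suc k} (\<lambda>_. borel)) (\<lambda>k \<omega>. restrict (\<lambda>i. p i \<omega>) {Suc k}) UNIV"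
    by (rule indep_vars_restrict[OF indep]) (auto simp: disjoint_family_on_def)
  then have "indep_vars (\<lambda>_. borel)
      (\<lambda>k \<omega>. t (Suc k) * (side c (restrict (\<lambda>i. p i \<omega>) {Suc k} (Suc k)) - g)) UNIV"
    by (rule indep_vars_compose2[where Y = "\<lambda>k f. t (Suc k) * (side c (f (Suc k)) - g)"])
      (intro borel_measurable_times borel_measurable_diff borel_measurable_const
        measurable_compose[OF _ side_meas] measurable_component_singleton singletonI)
  then have X_indep: "indep_vars (\<lambda>_. borel) X UNIV"
    by (simp add: X_def[abs_def])
  have "expectation (\<lambda>\<omega>. (X k \<omega>)\<^sup>2) \<le> 4 * (t (Suc k))\<^sup>2" for k
    using integral_mono[OF X_sq_int, of "\<lambda>_. 4 * (t (Suc k))\<^sup>2" k] X_sq_bound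
    by (simp add: prob_space)
  then have "summable (\<lambda>k. expectation (\<lambda>\<omega>. (X k \<omega>)\<^sup>2))"
    by (intro summable_comparison_test'[OF summable_mult[OF t_sq, of 4]]) auto
  from kolmogorov_one_series[OF X_indep X_int X_sq_int X_mean this]
  show ?thesis by (simp add: X_def g_def)
qed

text \<open>
  Since \<open>side\<close> is monotone in its first argument, a walk above the level \<open>c\<close> descends in each step
  by at least \<open>t * side c p\<close>, where \<open>p\<close> is the next sample.  For \<open>c\<close> above the median the sum of these
  terms is a drift that grows to infinity plus a convergent random series, so the walk eventually
  stays below every higher level; the reflected argument gives the lower bound.  Countably many
  levels accumulating at \<open>m\<close> suffice.
\<close>

lemma (in prob_space) median_walk_AE_tendsto:
  fixes p :: "nat \<Rightarrow> 'a \<Rightarrow> real"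
  assumes indep: "indep_vars (\<lambda>_. borel) p {1..}"
    and distr: "\<And>k. k \<ge> 1 \<Longrightarrow> distr M borel (p k) = \<nu>" and nu: "real_distribution \<nu>"
    and med: "unique_median \<nu> m"
    and t_pos: "\<And>k. k \<ge> 1 \<Longrightarrow> t k > 0"
    and t_sum: "filterlim (\<lambda>n. \<Sum>k=1..n. t k) at_top sequentially"
    and t_sq: "summable (\<lambda>k. (t (Suc k))\<^sup>2)"
  shows "AE \<omega> in M. (\<lambda>n. median_walk t (\<lambda>k. p k \<omega>) y n) \<longlonglongrightarrow> m"
proof -
  have "(\<lambda>k. sqrt ((t (Suc k))\<^sup>2)) \<longlonglongrightarrow> sqrt 0"
    by (intro tendsto_real_sqrt summable_LIMSEQ_zero[OF t_sq])
  then have t_lim: "(\<lambda>k. t (Suc k)) \<longlonglongrightarrow> 0"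
    using tendsto_rabs_zero_cancel by simp
  have t_div: "filterlim (\<lambda>n. \<Sum>k<n. t (Suc k) * d) at_top sequentially" if "d > 0" for d
  proof -
    have "filterlim (\<lambda>n. d * (\<Sum>k<n. t (Suc k))) at_top sequentially"
      using t_sum that
      by (intro filterlim_tendsto_pos_mult_at_top[OF tendsto_const])
        (auto simp: sum.atLeast1_atMost_eq)
    then show ?thesis by (simp add: sum_distrib_left mult.commute)
  qed
  define \<eta> where "\<eta> j = inverse (real (Suc j))" for j
  define e where "e c k \<omega> = t (Suc k) * (side c (p (Suc k) \<omega>) - (2 * cdf \<nu> c - 1))" for c k \<omega>
  have "AE \<omega> in M. summable (\<lambda>k. e c k \<omega>)" for c
    unfolding e_def by (rule sampled_sides_series[OF indep distr nu t_sq])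
  then have "AE \<omega> in M. \<forall>j. summable (\<lambda>k. e (m + \<eta> j) k \<omega>) \<and> summable (\<lambda>k. e (m - \<eta> j) k \<omega>)"
    unfolding AE_all_countable by auto
  then show ?thesis
  proof eventually_elim
    case (elim \<omega>)
    define w where "w n = median_walk t (\<lambda>k. p k \<omega>) y n" for n
    have w_Suc: "w (Suc n) = w n - t (Suc n) * side (w n) (p (Suc n) \<omega>)" for n
      by (simp add: w_def)
    have t_side: "\<bar>t (Suc n) * side (w n) (p (Suc n) \<omega>)\<bar> = t (Suc n)" for n
      using t_pos[of "Suc n"] by (simp add: abs_mult)
    have "eventually (\<lambda>n. \<bar>w n - m\<bar> \<le> 2 * \<delta>) sequentially" if "\<delta> > 0" for \<delta>
    proof -
      obtain j where j: "\<eta> j < \<delta>" using reals_Archimedean[OF \<open>\<delta> > 0\<close>] by (auto simp: \<eta>_def)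
      have \<eta>_pos: "\<eta> j > 0" by (simp add: \<eta>_def)
      define c where "c = m + \<eta> j"
      define b where "b = m - \<eta> j"
      have c_pos: "2 * cdf \<nu> c - 1 > 0" and b_neg: "1 - 2 * cdf \<nu> b > 0"
        using med \<eta>_pos unfolding unique_median_def c_def b_def
        by (force dest: spec[of _ "m + \<eta> j"], force dest: spec[of _ "m - \<eta> j"])
      have upper: "eventually (\<lambda>n. w n \<le> c + \<delta>) sequentially"
      proof (rule eventually_below_level[where e = "\<lambda>n. e c n \<omega>"
            and a = "\<lambda>n. t (Suc n) * (2 * cdf \<nu> c - 1)" and \<tau> = "\<lambda>n. t (Suc n)"])
        fix n
        show "w (Suc n) \<le> w n - t (Suc n) * (2 * cdf \<nu> c - 1) - e c n \<omega>" if "w n > c"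
        proof -
          have "t (Suc n) * side c (p (Suc n) \<omega>) \<le> t (Suc n) * side (w n) (p (Suc n) \<omega>)"
            using that t_pos[of "Suc n"] by (intro mult_left_mono side_mono) auto
          then show ?thesis by (simp add: w_Suc e_def algebra_simps)
        qed
        show "w (Suc n) \<le> w n + t (Suc n)" using t_side[of n] by (simp add: w_Suc)
        show "0 \<le> t (Suc n) * (2 * cdf \<nu> c - 1)" using c_pos t_pos[of "Suc n"] by simp
      qed (use t_lim t_div[OF c_pos] elim \<open>\<delta> > 0\<close> in \<open>auto simp: c_def\<close>)
      have lower: "eventually (\<lambda>n. - w n \<le> - b + \<delta>) sequentially"
      proof (rule eventually_below_level[where e = "\<lambda>n. - e b n \<omega>"
            and a = "\<lambda>n. t (Suc n) * (1 - 2 * cdf \<nu> b)" and \<tau> = "\<lambda>n. t (Suc n)"])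
        fix n
        show "- w (Suc n) \<le> - w n - t (Suc n) * (1 - 2 * cdf \<nu> b) - (- e b n \<omega>)" if "- w n > - b"
        proof -
          have "t (Suc n) * side (w n) (p (Suc n) \<omega>) \<le> t (Suc n) * side b (p (Suc n) \<omega>)"
            using that t_pos[of "Suc n"] by (intro mult_left_mono side_mono) auto
          then show ?thesis by (simp add: w_Suc e_def algebra_simps)
        qed
        show "- w (Suc n) \<le> - w n + t (Suc n)" using t_side[of n] by (simp add: w_Suc)
        show "0 \<le> t (Suc n) * (1 - 2 * cdf \<nu> b)" using b_neg t_pos[of "Suc n"] by simp
        show "summable (\<lambda>n. - e b n \<omega>)" using elim by (auto simp: b_def intro: summable_minus)
      qed (use t_lim t_div[OF b_neg] \<open>\<delta> > 0\<close> in auto)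
      from upper lower show ?thesis
        by eventually_elim (use j in \<open>auto simp: c_def b_def abs_le_iff\<close>)
    qed
    note close = this
    have "eventually (\<lambda>n. dist (w n) m < r) sequentially" if "r > 0" for r
    proof -
      have "r / 4 > 0" using that by simp
      from close[OF this] show ?thesis
        by eventually_elim (use that in \<open>simp add: dist_real_def\<close>)
    qed
    then show ?case unfolding w_def by (rule tendstoI)
  qed
qed

section \<open>Projections of planar measures\<close>

lemma space_borel_trace:
  fixes K :: "'b::topological_space set"
  assumes "sets \<mu> = sets (restrict_space borel K)"
  shows "space \<mu> = K"
  using sets_eq_imp_space_eq[OF assms] by (simp add: space_restrict_space)

lemma measurable_borel_trace:
  fixes K :: "'b::topological_space set"
  assumes "sets \<mu> = sets (restrict_space borel K)" and "f \<in> measurable borel N"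
  shows "f \<in> measurable \<mu> N"
  using measurable_restrict_space1[OF assms(2)] measurable_cong_sets[OF assms(1) refl] by blast

text \<open>
  The image of the connected support \<open>K\<close> is connected, and because \<open>f\<close> does not increase distances,
  the \<open>\<epsilon>\<close>-interval around \<open>f p\<close> receives at least the mass of the \<open>\<epsilon>\<close>-ball around \<open>p\<close>.  So the
  existence criterion for a unique median applies to the image measure.
\<close>

lemma marginal_unique_median:
  fixes f :: "'b::metric_space \<Rightarrow> real"
  assumes mu_prob: "prob_space \<mu>" and mu_sets: "sets \<mu> = sets (restrict_space borel K)"
    and conn: "connected K"
    and mu_pos: "\<And>p \<epsilon>. p \<in> K \<Longrightarrow> \<epsilon> > 0 \<Longrightarrow> measure \<mu> (ball p \<epsilon> \<inter> K) > 0"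
    and lip: "\<And>p q. \<bar>f p - f q\<bar> \<le> dist p q"
    and fibres: "\<And>x. measure \<mu> {p \<in> K. f p = x} = 0"
  shows "real_distribution (distr \<mu> borel f)" "\<exists>m. unique_median (distr \<mu> borel f) m"
proof -
  interpret mu: prob_space \<mu> by (rule mu_prob)
  note space = space_borel_trace[OF mu_sets]
  have cont: "continuous_on UNIV f"
    by (rule lipschitz_on_continuous_on[of 1]) (auto intro!: lipschitz_onI simp: dist_real_def lip)
  have f: "f \<in> borel_measurable \<mu>"
    by (rule measurable_borel_trace[OF mu_sets borel_measurable_continuous_onI[OF cont]])
  show real: "real_distribution (distr \<mu> borel f)"
    using mu.real_distribution_distr[OF f] .
  interpret nu: real_distribution "distr \<mu> borel f" by (rule real)
  have meas: "measure (distr \<mu> borel f) A = measure \<mu> {p \<in> K. f p \<in> A}" if "A \<in> sets borel" for A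
  proof -
    have "f -` A \<inter> K = {p \<in> K. f p \<in> A}" by auto
    then show ?thesis using measure_distr[OF f that] by (simp add: space)
  qed
  show "\<exists>m. unique_median (distr \<mu> borel f) m"
  proof (rule nu.unique_median_exists)
    show "measure (distr \<mu> borel f) {x} = 0" for x
      using meas[of "{x}"] fibres[of x] by simp
    show "connected (f ` K)"
      using conn cont by (intro connected_continuous_image continuous_on_subset[OF cont]) auto
    show "\<exists>s\<in>f ` K. s \<in> A" if "A \<in> sets borel" "measure (distr \<mu> borel f) A > 0" for A
    proof (rule ccontr)
      assume "\<not> (\<exists>s\<in>f ` K. s \<in> A)"
      then have "{p \<in> K. f p \<in> A} = {}" by blast
      with meas[OF that(1)] that(2) show False by simp
    qed
    show "measure (distr \<mu> borel f) {s-\<epsilon><..<s+\<epsilon>} > 0" if "s \<in> f ` K" "\<epsilon> > 0" for s \<epsilon>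
    proof -
      obtain p where p: "p \<in> K" "s = f p" using \<open>s \<in> f ` K\<close> by blast
      have "0 < measure \<mu> (ball p \<epsilon> \<inter> K)" by (rule mu_pos[OF p(1) \<open>\<epsilon> > 0\<close>])
      also have "\<dots> \<le> measure \<mu> {q \<in> K. f q \<in> {s-\<epsilon><..<s+\<epsilon>}}"
      proof (rule mu.finite_measure_mono)
        show "ball p \<epsilon> \<inter> K \<subseteq> {q \<in> K. f q \<in> {s-\<epsilon><..<s+\<epsilon>}}"
        proof
          fix q assume q: "q \<in> ball p \<epsilon> \<inter> K"
          with lip[of p q] have "\<bar>f p - f q\<bar> < \<epsilon>" by auto
          with q show "q \<in> {q \<in> K. f q \<in> {s-\<epsilon><..<s+\<epsilon>}}" by (auto simp: p(2))
        qed
        have "f -` {s-\<epsilon><..<s+\<epsilon>} \<inter> space \<mu> \<in> sets \<mu>"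
          by (intro measurable_sets[OF f]) simp
        then show "{q \<in> K. f q \<in> {s-\<epsilon><..<s+\<epsilon>}} \<in> sets \<mu>"
          by (simp add: space Int_def vimage_def conj_commute)
      qed
      also have "\<dots> = measure (distr \<mu> borel f) {s-\<epsilon><..<s+\<epsilon>}"
        by (rule meas[symmetric]) simp
      finally show ?thesis .
    qed
  qed
qed

lemma (in prob_space) iid_projection_walk_tendsto:
  fixes f :: "real \<times> real \<Rightarrow> real"
  assumes iid: "iid_sample M P \<mu>" and mu_sets: "sets \<mu> = sets (restrict_space borel K)"
    and f: "f \<in> borel_measurable borel"
    and nu: "real_distribution (distr \<mu> borel f)" and med: "unique_median (distr \<mu> borel f) m"
    and t_pos: "\<And>k. k \<ge> 1 \<Longrightarrow> t k > 0"
    and t_sum: "filterlim (\<lambda>n. \<Sum>k=1..n. t k) at_top sequentially"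
    and t_sq: "summable (\<lambda>k. (t (Suc k))\<^sup>2)"
  shows "AE \<omega> in M. (\<lambda>n. median_walk t (\<lambda>k. f (P k \<omega>)) y n) \<longlonglongrightarrow> m"
proof (rule median_walk_AE_tendsto[OF _ _ nu med t_pos t_sum t_sq])
  have indep: "indep_vars (\<lambda>_. borel) P {1..}"
    and dist: "\<And>k. k \<ge> 1 \<Longrightarrow> distr M borel (P k) = distr \<mu> borel (\<lambda>p. p)"
    using iid by (auto simp: iid_sample_def)
  show "indep_vars (\<lambda>_. borel) (\<lambda>k \<omega>. f (P k \<omega>)) {1..}"
    using f by (intro indep_vars_compose2[OF indep])
  have incl: "(\<lambda>p. p) \<in> borel_measurable \<mu>"
    by (rule measurable_borel_trace[OF mu_sets measurable_ident_sets[OF refl]])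
  show "distr M borel (\<lambda>\<omega>. f (P k \<omega>)) = distr \<mu> borel f" if "k \<ge> 1" for k
  proof -
    have P: "P k \<in> borel_measurable M" using indep that by (simp add: indep_vars_def)
    have "distr M borel (\<lambda>\<omega>. f (P k \<omega>)) = distr (distr M borel (P k)) borel f"
      using distr_distr[OF f P] by (simp add: comp_def)
    also have "\<dots> = distr \<mu> borel f"
      unfolding dist[OF that] using distr_distr[OF f incl] by (simp add: comp_def)
    finally show ?thesis .
  qed
qed

lemma (in prob_space) iid_sample_in_support:
  assumes iid: "iid_sample M P \<mu>" and mu_sets: "sets \<mu> = sets (restrict_space borel K)"
    and K: "K \<in> sets borel"
  shows "AE \<omega> in M. \<forall>k\<ge>1. P k \<omega> \<in> K"
proof -
  note space = space_borel_trace[OF mu_sets]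
  have incl: "(\<lambda>p. p) \<in> borel_measurable \<mu>"
    by (rule measurable_borel_trace[OF mu_sets measurable_ident_sets[OF refl]])
  have K': "{x \<in> space borel. x \<in> K} \<in> sets borel" using K by simp
  have "AE \<omega> in M. P k \<omega> \<in> K" if "k \<ge> 1" for k
  proof -
    have P: "P k \<in> borel_measurable M"
      and dist: "distr M borel (P k) = distr \<mu> borel (\<lambda>p. p)"
      using iid that by (auto simp: iid_sample_def indep_vars_def)
    have "AE p in \<mu>. p \<in> K" by (rule AE_I2) (simp add: space)
    then have "AE p in distr \<mu> borel (\<lambda>p. p). p \<in> K"
      using AE_distr_iff[OF incl K'] by simp
    then show ?thesis unfolding dist[symmetric] using AE_distr_iff[OF P K'] by blast
  qed
  then have "AE \<omega> in M. k \<ge> 1 \<longrightarrow> P k \<omega> \<in> K" for k by (cases "k \<ge> 1") auto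
  then show ?thesis by (simp add: AE_all_countable)
qed

section \<open>Moments, the conic function and the convergence theorem\<close>

lemma (in prob_space) bounded_tendsto_moments:
  fixes Z :: "nat \<Rightarrow> 'a \<Rightarrow> 'b::{real_normed_vector, second_countable_topology}"
  assumes meas: "\<And>n. Z n \<in> borel_measurable M"
    and bound: "AE \<omega> in M. \<forall>n. norm (Z n \<omega> - z) \<le> C"
    and lim: "AE \<omega> in M. (\<lambda>n. Z n \<omega>) \<longlonglongrightarrow> z" and "q \<ge> 1"
  shows "integrable M (\<lambda>\<omega>. norm (Z n \<omega> - z) ^ q)"
    and "(\<lambda>n. expectation (\<lambda>\<omega>. norm (Z n \<omega> - z) ^ q)) \<longlonglongrightarrow> 0"
proof -
  have Z: "(\<lambda>\<omega>. norm (Z n \<omega> - z) ^ q) \<in> borel_measurable M" for n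
    by (intro borel_measurable_power measurable_compose[OF _ borel_measurable_norm] borel_measurable_diff meas
        borel_measurable_const)
  have dom: "AE \<omega> in M. norm (norm (Z n \<omega> - z) ^ q) \<le> C ^ q" for n
    using bound by eventually_elim (auto intro: power_mono)
  show "integrable M (\<lambda>\<omega>. norm (Z n \<omega> - z) ^ q)"
    by (rule integrable_const_bound[OF dom Z])
  have "(\<lambda>n. expectation (\<lambda>\<omega>. norm (Z n \<omega> - z) ^ q)) \<longlonglongrightarrow> expectation (\<lambda>\<omega>. 0)"
  proof (rule integral_dominated_convergence[where w = "\<lambda>_. C ^ q"])
    show "AE \<omega> in M. (\<lambda>n. norm (Z n \<omega> - z) ^ q) \<longlonglongrightarrow> 0"
      using lim
    proof eventually_elim
      case (elim \<omega>)
      then have "(\<lambda>n. norm (Z n \<omega> - z)) \<longlonglongrightarrow> 0"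
        by (simp add: LIM_zero tendsto_norm_zero)
      from tendsto_power[OF this, of q] show ?case using \<open>q \<ge> 1\<close> by (simp add: power_0_left)
    qed
  qed (use Z dom in simp_all)
  then show "(\<lambda>n. expectation (\<lambda>\<omega>. norm (Z n \<omega> - z) ^ q)) \<longlonglongrightarrow> 0" by simp
qed

text \<open>
  The conic function is a sum of two one-dimensional mean absolute deviations, and can be
  minimized one coordinate at a time.
\<close>

lemma generalized_conic_eq_abs_deviations:
  assumes mu_prob: "prob_space \<mu>" and mu_sets: "sets \<mu> = sets (restrict_space borel K)"
    and bdd: "bounded K"
  shows "integrable (distr \<mu> borel fst) (\<lambda>p. p)" "integrable (distr \<mu> borel snd) (\<lambda>p. p)"
    and "generalized_conic K \<mu> z
      = (LINT p|distr \<mu> borel fst. \<bar>fst z - p\<bar>) + (LINT p|distr \<mu> borel snd. \<bar>snd z - p\<bar>)"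
proof -
  interpret mu: prob_space \<mu> by (rule mu_prob)
  note space = space_borel_trace[OF mu_sets]
  obtain B where B: "\<And>p. p \<in> K \<Longrightarrow> norm p \<le> B" using bdd by (auto simp: bounded_iff)
  have meas: "fst \<in> borel_measurable \<mu>" "snd \<in> borel_measurable \<mu>"
    by (intro measurable_borel_trace[OF mu_sets] borel_measurable_continuous_onI continuous_intros)+
  have "norm (fst p) \<le> B" "norm (snd p) \<le> B" if "p \<in> K" for p
    using B[OF that] norm_fst_le[of "fst p" "snd p"] norm_snd_le[of "snd p" "fst p"] by auto
  then have int: "integrable \<mu> fst" "integrable \<mu> snd"
    using meas by (auto intro!: mu.integrable_const_bound[where B = B] AE_I2 simp: space)
  show "integrable (distr \<mu> borel fst) (\<lambda>p. p)" "integrable (distr \<mu> borel snd) (\<lambda>p. p)"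
    using int meas by (simp_all add: integrable_distr_eq)
  have "generalized_conic K \<mu> z = (LINT p|\<mu>. \<bar>fst z - fst p\<bar> + \<bar>snd z - snd p\<bar>)"
    unfolding generalized_conic_def set_lebesgue_integral_def
    by (intro Bochner_Integration.integral_cong) (auto simp: space)
  also have "\<dots> = (LINT p|\<mu>. \<bar>fst z - fst p\<bar>) + (LINT p|\<mu>. \<bar>snd z - snd p\<bar>)"
    using int by (intro Bochner_Integration.integral_add) auto
  also have "\<dots> = (LINT p|distr \<mu> borel fst. \<bar>fst z - p\<bar>) + (LINT p|distr \<mu> borel snd. \<bar>snd z - p\<bar>)"
    using meas by (simp add: integral_distr)
  finally show "generalized_conic K \<mu> z
      = (LINT p|distr \<mu> borel fst. \<bar>fst z - p\<bar>) + (LINT p|distr \<mu> borel snd. \<bar>snd z - p\<bar>)" .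
qed

theorem theorem3p2:
  fixes K :: "(real \<times> real) set"
    and \<mu> :: "(real \<times> real) measure"
    and t :: "nat \<Rightarrow> real"
    and x\<^sub>0 :: "real \<times> real"
    and M :: "'a measure"
    and P :: "nat \<Rightarrow> 'a \<Rightarrow> real \<times> real"
  assumes body: "compact_body K" and conn: "connected K"
    and mu_prob: "prob_space \<mu>" and mu_sets: "sets \<mu> = sets (restrict_space borel K)"
    and mu_pos: "\<And>p \<epsilon>. p \<in> K \<Longrightarrow> \<epsilon> > 0 \<Longrightarrow> measure \<mu> (ball p \<epsilon> \<inter> K) > 0"
    and mu_vert: "\<And>x. measure \<mu> {p \<in> K. fst p = x} = 0"
    and mu_horiz: "\<And>y. measure \<mu> {p \<in> K. snd p = y} = 0"
    and t_pos: "\<And>k. k \<ge> 1 \<Longrightarrow> t k > 0"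
    and t_decr: "\<And>k l. 1 \<le> k \<Longrightarrow> k \<le> l \<Longrightarrow> t l \<le> t k"
    and t_sum: "filterlim (\<lambda>n. \<Sum>k=1..n. t k) at_top sequentially"
    and t_sq: "summable (\<lambda>k. (t (Suc k))\<^sup>2)"
    and x0: "x\<^sub>0 \<in> K"
    and M_prob: "prob_space M" and P_iid: "iid_sample M P \<mu>"
  shows "\<exists>X. global_minimizer (generalized_conic K \<mu>) X
           \<and> (\<forall>Y. global_minimizer (generalized_conic K \<mu>) Y \<longrightarrow> Y = X)
           \<and> (AE \<omega> in M. (\<lambda>n. stoch_iter t P x\<^sub>0 n \<omega>) \<longlonglongrightarrow> X)
           \<and> (\<forall>q::nat. q \<ge> 1 \<longrightarrow>
                (\<forall>n. integrable M (\<lambda>\<omega>. norm (stoch_iter t P x\<^sub>0 n \<omega> - X) ^ q))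
              \<and> (\<lambda>n. LINT \<omega>|M. norm (stoch_iter t P x\<^sub>0 n \<omega> - X) ^ q) \<longlonglongrightarrow> 0)"
proof -
  interpret M: prob_space M by (rule M_prob)
  have "compact K" using body by (simp add: compact_body_def)
  then have K_borel: "K \<in> sets borel" and K_bdd: "bounded K"
    by (auto simp: compact_imp_closed compact_imp_bounded)
  have cont: "continuous_on UNIV (fst :: real \<times> real \<Rightarrow> real)"
    "continuous_on UNIV (snd :: real \<times> real \<Rightarrow> real)"
    by (auto intro: continuous_intros)
  have lip: "\<bar>fst p - fst q\<bar> \<le> dist p q" "\<bar>snd p - snd q\<bar> \<le> dist p q" for p q :: "real \<times> real"
    using dist_fst_le[of p q] dist_snd_le[of p q] by (simp_all add: dist_real_def)
  define \<nu> where "\<nu> = distr \<mu> borel fst"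
  define \<xi> where "\<xi> = distr \<mu> borel snd"
  note fst_marginal = marginal_unique_median[OF mu_prob mu_sets conn mu_pos lip(1) mu_vert]
  note snd_marginal = marginal_unique_median[OF mu_prob mu_sets conn mu_pos lip(2) mu_horiz]
  obtain a where a: "unique_median \<nu> a" using fst_marginal(2) by (auto simp: \<nu>_def)
  obtain b where b: "unique_median \<xi> b" using snd_marginal(2) by (auto simp: \<xi>_def)
  interpret nu: real_distribution \<nu> unfolding \<nu>_def by (rule fst_marginal(1))
  interpret xi: real_distribution \<xi> unfolding \<xi>_def by (rule snd_marginal(1))
  note conic = generalized_conic_eq_abs_deviations[OF mu_prob mu_sets K_bdd, folded \<nu>_def \<xi>_def]
  have less: "generalized_conic K \<mu> (a, b) < generalized_conic K \<mu> z" if "z \<noteq> (a, b)" for z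
  proof -
    have fst: "nu.expectation (\<lambda>p. \<bar>a - p\<bar>) < nu.expectation (\<lambda>p. \<bar>fst z - p\<bar>)" if "fst z \<noteq> a"
      by (rule nu.median_minimizes_abs_deviation[OF conic(1) a that])
    have snd: "xi.expectation (\<lambda>p. \<bar>b - p\<bar>) < xi.expectation (\<lambda>p. \<bar>snd z - p\<bar>)" if "snd z \<noteq> b"
      by (rule xi.median_minimizes_abs_deviation[OF conic(2) b that])
    have "fst z \<noteq> a \<or> snd z \<noteq> b" using that by (auto simp: prod_eq_iff)
    with fst snd show ?thesis
      by (cases "fst z = a"; cases "snd z = b") (auto simp: conic(3) intro: add_strict_mono)
  qed
  have min: "global_minimizer (generalized_conic K \<mu>) (a, b)"
    unfolding global_minimizer_def using less by (metis less_imp_le order_refl)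
  have uniq: "Y = (a, b)" if "global_minimizer (generalized_conic K \<mu>) Y" for Y
    using that less[of Y] unfolding global_minimizer_def by (meson not_le)
  have fst_lim: "AE \<omega> in M. (\<lambda>n. median_walk t (\<lambda>k. fst (P k \<omega>)) (fst x\<^sub>0) n) \<longlonglongrightarrow> a"
    using M.iid_projection_walk_tendsto[OF P_iid mu_sets
        borel_measurable_continuous_onI[OF cont(1)] fst_marginal(1) a[unfolded \<nu>_def] t_pos t_sum t_sq] .
  have snd_lim: "AE \<omega> in M. (\<lambda>n. median_walk t (\<lambda>k. snd (P k \<omega>)) (snd x\<^sub>0) n) \<longlonglongrightarrow> b"
    using M.iid_projection_walk_tendsto[OF P_iid mu_sets
        borel_measurable_continuous_onI[OF cont(2)] snd_marginal(1) b[unfolded \<xi>_def] t_pos t_sum t_sq] .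
  have lim: "AE \<omega> in M. (\<lambda>n. stoch_iter t P x\<^sub>0 n \<omega>) \<longlonglongrightarrow> (a, b)"
    using fst_lim snd_lim
    by eventually_elim (simp add: stoch_iter_eq_median_walks tendsto_Pair)
  have P_meas: "P k \<in> borel_measurable M" if "k \<ge> 1" for k
    using P_iid that by (simp add: iid_sample_def M.indep_vars_def)
  have meas: "stoch_iter t P x\<^sub>0 n \<in> borel_measurable M" for n
    unfolding stoch_iter_eq_median_walks[abs_def]
    by (intro borel_measurable_Pair measurable_median_walk
        measurable_compose[OF P_meas borel_measurable_continuous_onI] cont)
  obtain B where B: "\<And>p. p \<in> K \<Longrightarrow> norm p \<le> B" using K_bdd by (auto simp: bounded_iff)
  have B_coord: "\<bar>fst p\<bar> \<le> B" "\<bar>snd p\<bar> \<le> B" if "p \<in> K" for p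
    using B[OF that] norm_fst_le[of "fst p" "snd p"] norm_snd_le[of "snd p" "fst p"] by auto
  define C where "C = (B + t 1 + \<bar>a\<bar>) + (B + t 1 + \<bar>b\<bar>)"
  have bound: "AE \<omega> in M. \<forall>n. norm (stoch_iter t P x\<^sub>0 n \<omega> - (a, b)) \<le> C"
    using M.iid_sample_in_support[OF P_iid mu_sets K_borel]
  proof eventually_elim
    case (elim \<omega>)
    show ?case
    proof
      fix n
      have "\<bar>median_walk t (\<lambda>k. fst (P k \<omega>)) (fst x\<^sub>0) n\<bar> \<le> B + t 1"
        using elim x0 by (intro median_walk_bounded t_pos t_decr B_coord) auto
      moreover have "\<bar>median_walk t (\<lambda>k. snd (P k \<omega>)) (snd x\<^sub>0) n\<bar> \<le> B + t 1"
        using elim x0 by (intro median_walk_bounded t_pos t_decr B_coord) auto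
      ultimately show "norm (stoch_iter t P x\<^sub>0 n \<omega> - (a, b)) \<le> C"
        unfolding stoch_iter_eq_median_walks C_def
        by (intro order_trans[OF norm_Pair_le[of "_ - _" "_ - _", folded diff_Pair] add_mono]) auto
    qed
  qed
  show ?thesis
    using min uniq lim M.bounded_tendsto_moments[OF meas bound lim] by blast
qed

end
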